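(* Let $G\in\mathbb{GS}$ and let $r,s$ be nonnegative real numbers. Let $m(G)=\max\{|t|:\emptyset^t\text{ is an atom occurring in }G\}$ and define the $(r,s)$-adjoint $G^\circ_{r,s}=\overleftrightarrow{G}+\langle\emptyset^{-m(G)-r-1}\mid\emptyset^{m(G)+s+1}\rangle$. Then $Ls(G+G^\circ_{r,s})<-r$ and $Rs(G+G^\circ_{r,s})>s$.
   Context: A scoring game is written $G=\langle G^{\mathcal L}\mid G^{\mathcal R}\rangle$, where each of $G^{\mathcal L}$ (Left options) and $G^{\mathcal R}$ (Right options) is either a finite nonempty set of scoring games or an atom $\emptyset^{s}$, $s\in\mathbb R$ (the player to move on that side cannot move and the game ends with score $s$); game trees are finite. An atom occurring in $G$ is an atom of $G$ or of any follower of $G$. $G$ is guaranteed if for every follower $K$ of $G$: if $K^{\mathcal L}=\emptyset^\ell$ then $\ell\le s$ for every atom $\emptyset^s$ occurring in $K$, and if $K^{\mathcal R}=\emptyset^r$ then $s\le r$ for every atom $\emptyset^s$ occurring in $K$; $\mathbb{GS}$ is the class of guaranteed games. Disjunctive sum $G+H$: Left options are $G^L+H$ and $G+H^L$, except if both are left-atomic with atoms $\emptyset^{\ell_1},\emptyset^{\ell_2}$, then $(G+H)^{\mathcal L}=\emptyset^{\ell_1+\ell_2}$; Right symmetric. Stops: $Ls(G)=\ell$ if $G^{\mathcal L}=\emptyset^\ell$, otherwise $\max_{G^L}Rs(G^L)$; $Rs(G)=r$ if $G^{\mathcal R}=\emptyset^r$, otherwise $\min_{G^R}Ls(G^R)$.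 Conjugate: $\overleftrightarrow{G}=\langle\overleftrightarrow{G^{\mathcal R}}\mid\overleftrightarrow{G^{\mathcal L}}\rangle$, conjugating each option, with an atom $\emptyset^s$ becoming $\emptyset^{-s}$. *)

theory Defs
  imports Complex_Main "HOL-Library.FSet"
begin

datatype 'g side = Atom real | Opts (opts: "'g fset")
  where "opts (Atom s) = {||}"

text \<open>The datatype also contains games with an empty set of options on some side; these are
  not scoring games and are excluded by \<open>scoring_game\<close> below.\<close>

datatype game = Game (left: "game side") (right: "game side")

text \<open>\<open>follower G K\<close>: \<open>K\<close> is a follower of \<open>G\<close>. Every game counts as a follower of itself.\<close>

inductive follower :: "game \<Rightarrow> game \<Rightarrow> bool" for G :: game where
  follower_refl: "follower G G"
| follower_left: "follower G K \<Longrightarrow> X |\<in>| opts (left K) \<Longrightarrow> follower G X"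
| follower_right: "follower G K \<Longrightarrow> X |\<in>| opts (right K) \<Longrightarrow> follower G X"

definition scoring_game :: "game \<Rightarrow> bool" where
  "scoring_game G \<longleftrightarrow> (\<forall>K. follower G K \<longrightarrow> left K \<noteq> Opts {||} \<and> right K \<noteq> Opts {||})"

definition atoms :: "game \<Rightarrow> real set" where
  "atoms G = {s. \<exists>K. follower G K \<and> (left K = Atom s \<or> right K = Atom s)}"

definition guaranteed :: "game \<Rightarrow> bool" where
  "guaranteed G \<longleftrightarrow> (\<forall>K. follower G K \<longrightarrow>
     (\<forall>l. left K = Atom l \<longrightarrow> (\<forall>s\<in>atoms K. l \<le> s)) \<and>
     (\<forall>r. right K = Atom r \<longrightarrow> (\<forall>s\<in>atoms K. s \<le> r)))"

definition GS :: "game set" where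
  "GS = {G. scoring_game G \<and> guaranteed G}"

lemma size_opts: "X |\<in>| A \<Longrightarrow> size X < Suc (\<Sum>x\<in>fset A. Suc (size x))"
  for X :: game
  using member_le_sum[of X "fset A" "\<lambda>x. Suc (size x)"] by simp

lemma size_left: "left G = Opts A \<Longrightarrow> X |\<in>| A \<Longrightarrow> size X < size G"
  using size_opts[of X A] by (cases G) simp

lemma size_right: "right G = Opts A \<Longrightarrow> X |\<in>| A \<Longrightarrow> size X < size G"
  using size_opts[of X A] by (cases G) simp

lemma fimage_fundef_cong [fundef_cong]:
  "A = B \<Longrightarrow> (\<And>x. x |\<in>| B \<Longrightarrow> f x = g x) \<Longrightarrow> f |`| A = g |`| B"
  by (rule fset.map_cong)

function game_sum :: "game \<Rightarrow> game \<Rightarrow> game" (infixl "\<oplus>" 65) where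
  "G \<oplus> H = Game
     (case left G of
        Atom a \<Rightarrow> (case left H of
            Atom b \<Rightarrow> Atom (a + b)
          | Opts B \<Rightarrow> Opts ((\<lambda>X. G \<oplus> X) |`| B))
      | Opts A \<Rightarrow> (case left H of
            Atom b \<Rightarrow> Opts ((\<lambda>X. X \<oplus> H) |`| A)
          | Opts B \<Rightarrow> Opts ((\<lambda>X. X \<oplus> H) |`| A |\<union>| (\<lambda>X. G \<oplus> X) |`| B)))
     (case right G of
        Atom a \<Rightarrow> (case right H of
            Atom b \<Rightarrow> Atom (a + b)
          | Opts B \<Rightarrow> Opts ((\<lambda>X. G \<oplus> X) |`| B))
      | Opts A \<Rightarrow> (case right H of
            Atom b \<Rightarrow> Opts ((\<lambda>X. X \<oplus> H) |`| A)
          | Opts B \<Rightarrow> Opts ((\<lambda>X. X \<oplus> H) |`| A |\<union>| (\<lambda>X. G \<oplus> X) |`| B)))"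
  by pat_completeness auto
termination
  by (relation "measure (\<lambda>(G, H). size G + size H)") (auto dest: size_left size_right)

function Ls :: "game \<Rightarrow> real" and Rs :: "game \<Rightarrow> real" where
  "Ls G = (case left G of Atom l \<Rightarrow> l | Opts A \<Rightarrow> Max (Rs ` fset A))"
| "Rs G = (case right G of Atom r \<Rightarrow> r | Opts A \<Rightarrow> Min (Ls ` fset A))"
  by pat_completeness auto
termination
  by (relation "measure (case_sum size size)") (auto dest: size_left size_right)

function conjugate :: "game \<Rightarrow> game" where
  "conjugate G = Game
     (case right G of Atom s \<Rightarrow> Atom (- s) | Opts A \<Rightarrow> Opts (conjugate |`| A))
     (case left G of Atom s \<Rightarrow> Atom (- s) | Opts A \<Rightarrow> Opts (conjugate |`| A))"
  by pat_completeness auto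
termination
  by (relation "measure size") (auto dest: size_left size_right)

text \<open>The equations of these functions are unconditional in a variable argument, hence would loop
  as rewrite rules.\<close>

declare game_sum.simps [simp del] Ls.simps [simp del] Rs.simps [simp del]
  conjugate.simps [simp del]

definition max_atom :: "game \<Rightarrow> real" where
  "max_atom G = Max {\<bar>t\<bar> | t. t \<in> atoms G}"

definition adjoint :: "real \<Rightarrow> real \<Rightarrow> game \<Rightarrow> game" where
  "adjoint r s G =
     conjugate G \<oplus> Game (Atom (- max_atom G - r - 1)) (Atom (max_atom G + s + 1))"

lemma finite_followers: "finite {K. follower G K}"
proof (induction "size G" arbitrary: G rule: less_induct)
  case less
  let ?O = "fset (opts (left G)) \<union> fset (opts (right G))"
  have "K = G \<or> (\<exists>X\<in>?O. follower X K)" if "follower G K" for K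
    using that by induction (auto intro: follower.intros)
  then have "{K. follower G K} \<subseteq> insert G (\<Union>X\<in>?O. {K. follower X K})"
    by auto
  moreover have "size X < size G" if "X \<in> ?O" for X
    using that by (cases "left G"; cases "right G") (auto dest: size_left size_right)
  then have "finite (insert G (\<Union>X\<in>?O. {K. follower X K}))"
    using less by (intro finite.insertI finite_UN_I) auto
  ultimately show ?case
    using finite_subset by blast
qed

lemma finite_atoms: "finite (atoms G)"
proof -
  have "atoms G \<subseteq> (\<Union>K\<in>{K. follower G K}. {s. left K = Atom s} \<union> {s. right K = Atom s})"
    by (auto simp: atoms_def)
  moreover have "finite {s. A = Atom s}" for A :: "game side"
    by (cases A) auto
  ultimately show ?thesis
    by (meson finite_UN_I finite_UnI finite_followers finite_subset)
qed

lemma atoms_nonempty: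
  assumes "scoring_game G"
  shows "atoms G \<noteq> {}"
proof -
  obtain K where K: "follower G K" and min: "\<And>L. follower G L \<Longrightarrow> size K \<le> size L"
    using follower_refl
    by (metis arg_min_nat_lemma)
  show ?thesis
  proof (cases "left K")
    case (Atom s)
    with K show ?thesis by (auto simp: atoms_def)
  next
    case (Opts A)
    with assms K obtain X where "X |\<in>| A"
      unfolding scoring_game_def by (metis equalsffemptyI)
    with Opts K have "follower G X" "size X < size K"
      by (auto intro: follower_left size_left)
    with min show ?thesis by fastforce
  qed
qed

end

theory Submission
  imports Defs
begin

text \<open>In \<open>G \<oplus> conjugate G \<oplus> Z\<close>, where Left has no move in \<open>Z\<close>, Right answers every move of
  Left by its mirror image, which leads to a position \<open>X \<oplus> conjugate X \<oplus> Z\<close> of the same form. Left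
  runs out of moves only when \<open>G\<close> is atomic on both sides, with atoms \<open>a\<close> and \<open>b\<close>; since \<open>G\<close> is
  guaranteed, \<open>a \<le> b\<close>, so the final score \<open>a - b + p\<close> is at most the left atom \<open>p\<close> of \<open>Z\<close>.
  Conjugation exchanges the players and turns this bound into the one for the Right stop.\<close>

lemma side_eqI: "opts A = opts B \<Longrightarrow> (\<And>s. A = Atom s \<longleftrightarrow> B = Atom s) \<Longrightarrow> A = B"
  by (cases A; cases B) auto

lemma game_eqI:
  assumes "opts (left G) = opts (left H)" "\<And>a. left G = Atom a \<longleftrightarrow> left H = Atom a"
    and "opts (right G) = opts (right H)" "\<And>a. right G = Atom a \<longleftrightarrow> right H = Atom a"
  shows "G = H"
  using assms by (intro game.expand conjI side_eqI)

abbreviation moves :: "game \<Rightarrow> game fset" where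
  "moves G \<equiv> opts (left G) |\<union>| opts (right G)"

lemma size_move_less: "X |\<in>| moves G \<Longrightarrow> size X < size G"
  by (cases "left G"; cases "right G") (auto dest: size_left size_right)

lemma follower_move: "X |\<in>| moves G \<Longrightarrow> follower G X"
  using follower_left[OF follower_refl] follower_right[OF follower_refl] by auto

lemma opts_game_sum:
  "opts (left (G \<oplus> H)) = (\<lambda>X. X \<oplus> H) |`| opts (left G) |\<union>| (\<lambda>X. G \<oplus> X) |`| opts (left H)"
  "opts (right (G \<oplus> H)) = (\<lambda>X. X \<oplus> H) |`| opts (right G) |\<union>| (\<lambda>X. G \<oplus> X) |`| opts (right H)"
  by (subst game_sum.simps; auto split: side.splits)+

lemma game_sum_eq_Atom_iff:
  "left (G \<oplus> H) = Atom c \<longleftrightarrow> (\<exists>a b. left G = Atom a \<and> left H = Atom b \<and> c = a + b)"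
  "right (G \<oplus> H) = Atom c \<longleftrightarrow> (\<exists>a b. right G = Atom a \<and> right H = Atom b \<and> c = a + b)"
  by (subst game_sum.simps; auto split: side.splits)+

lemma opts_conjugate:
  "opts (left (conjugate G)) = conjugate |`| opts (right G)"
  "opts (right (conjugate G)) = conjugate |`| opts (left G)"
  by (subst conjugate.simps; auto split: side.splits)+

lemma conjugate_eq_Atom_iff:
  "left (conjugate G) = Atom c \<longleftrightarrow> (\<exists>b. right G = Atom b \<and> c = - b)"
  "right (conjugate G) = Atom c \<longleftrightarrow> (\<exists>a. left G = Atom a \<and> c = - a)"
  by (subst conjugate.simps; auto split: side.splits)+

lemma game_sum_commute: "G \<oplus> H = H \<oplus> G"
proof (induction "size G + size H" arbitrary: G H rule: less_induct)
  case less
  have "X \<oplus> H = H \<oplus> X" if "X |\<in>| moves G" for X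
    by (rule less) (use size_move_less[OF that] in simp)
  moreover have "G \<oplus> X = X \<oplus> G" if "X |\<in>| moves H" for X
    by (rule less) (use size_move_less[OF that] in simp)
  ultimately show ?case
    by (intro game_eqI)
      (auto simp: opts_game_sum game_sum_eq_Atom_iff funion_commute cong: fset.map_cong)
qed

lemma game_sum_assoc: "G \<oplus> H \<oplus> K = G \<oplus> (H \<oplus> K)"
proof (induction "size G + size H + size K" arbitrary: G H K rule: less_induct)
  case less
  have "X \<oplus> H \<oplus> K = X \<oplus> (H \<oplus> K)" if "X |\<in>| moves G" for X
    by (rule less) (use size_move_less[OF that] in simp)
  moreover have "G \<oplus> X \<oplus> K = G \<oplus> (X \<oplus> K)" if "X |\<in>| moves H" for X
    by (rule less) (use size_move_less[OF that] in simp)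
  moreover have "G \<oplus> H \<oplus> X = G \<oplus> (H \<oplus> X)" if "X |\<in>| moves K" for X
    by (rule less) (use size_move_less[OF that] in simp)
  ultimately show ?case
    by (intro game_eqI)
      (auto simp: opts_game_sum game_sum_eq_Atom_iff add.assoc fimage_funion comp_def
        funion_assoc cong: fset.map_cong)
qed

lemma conjugate_conjugate: "conjugate (conjugate G) = G"
proof (induction G rule: measure_induct_rule[where f = size])
  case (less G)
  have "conjugate (conjugate X) = X" if "X |\<in>| moves G" for X
    using size_move_less[OF that] by (rule less)
  then show ?case
    by (intro game_eqI)
      (auto simp: opts_conjugate conjugate_eq_Atom_iff comp_def cong: fset.map_cong)
qed

lemma conjugate_game_sum: "conjugate (G \<oplus> H) = conjugate G \<oplus> conjugate H"
proof (induction "size G + size H" arbitrary: G H rule: less_induct)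
  case less
  have "conjugate (X \<oplus> H) = conjugate X \<oplus> conjugate H"
    if "X |\<in>| moves G" for X
    by (rule less) (use size_move_less[OF that] in simp)
  moreover have "conjugate (G \<oplus> X) = conjugate G \<oplus> conjugate X"
    if "X |\<in>| moves H" for X
    by (rule less) (use size_move_less[OF that] in simp)
  ultimately show ?case
    by (intro game_eqI)
      (auto simp: opts_game_sum opts_conjugate game_sum_eq_Atom_iff conjugate_eq_Atom_iff
        fimage_funion comp_def cong: fset.map_cong)
qed

lemma follower_trans: "follower H K \<Longrightarrow> follower G H \<Longrightarrow> follower G K"
  by (induction rule: follower.induct) (auto intro: follower.intros)

lemma follower_game_sumD:
  "follower (G \<oplus> H) K \<Longrightarrow> \<exists>G' H'. K = G' \<oplus> H' \<and> follower G G' \<and> follower H H'"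
  by (induction rule: follower.induct) (fastforce simp: opts_game_sum intro: follower.intros)+

lemma follower_conjugateD:
  "follower (conjugate G) K \<Longrightarrow> \<exists>G'. K = conjugate G' \<and> follower G G'"
  by (induction rule: follower.induct) (fastforce simp: opts_conjugate intro: follower.intros)+

lemma scoring_game_game_sum:
  assumes "scoring_game G" "scoring_game H"
  shows "scoring_game (G \<oplus> H)"
  unfolding scoring_game_def
proof (intro allI impI)
  fix K assume "follower (G \<oplus> H) K"
  then obtain G' H' where "K = G' \<oplus> H'" "follower G G'" "follower H H'"
    using follower_game_sumD by blast
  with assms show "left K \<noteq> Opts {||} \<and> right K \<noteq> Opts {||}"
    unfolding scoring_game_def by (auto simp: game_sum.simps[of G' H'] split: side.splits)
qed

lemma scoring_game_conjugate:
  assumes "scoring_game G"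
  shows "scoring_game (conjugate G)"
  unfolding scoring_game_def
proof (intro allI impI)
  fix K assume "follower (conjugate G) K"
  then obtain G' where "K = conjugate G'" "follower G G'"
    using follower_conjugateD by blast
  with assms show "left K \<noteq> Opts {||} \<and> right K \<noteq> Opts {||}"
    unfolding scoring_game_def by (auto simp: conjugate.simps[of G'] split: side.splits)
qed

lemma scoring_game_follower: "scoring_game G \<Longrightarrow> follower G K \<Longrightarrow> scoring_game K"
  unfolding scoring_game_def by (blast intro: follower_trans)

lemma guaranteed_follower: "guaranteed G \<Longrightarrow> follower G K \<Longrightarrow> guaranteed K"
  unfolding guaranteed_def by (blast intro: follower_trans)

lemma GS_follower: "G \<in> GS \<Longrightarrow> follower G K \<Longrightarrow> K \<in> GS"
  unfolding GS_def by (blast intro: scoring_game_follower guaranteed_follower)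

lemma scoring_game_nonempty:
  assumes "scoring_game G"
  shows "left G \<noteq> Opts {||}" "right G \<noteq> Opts {||}"
  using assms follower_refl unfolding scoring_game_def by blast+

lemma guaranteed_left_atom_le_right_atom:
  "guaranteed G \<Longrightarrow> left G = Atom a \<Longrightarrow> right G = Atom b \<Longrightarrow> a \<le> b"
  using follower_refl unfolding guaranteed_def atoms_def by blast

lemma Rs_le_Ls_option: "X |\<in>| opts (right G) \<Longrightarrow> Rs G \<le> Ls X"
  by (subst Rs.simps) (cases "right G"; auto)

lemma Ls_leI:
  assumes "left G \<noteq> Opts {||}"
    and "\<And>l. left G = Atom l \<Longrightarrow> l \<le> p"
    and "\<And>X. X |\<in>| opts (left G) \<Longrightarrow> Rs X \<le> p"
  shows "Ls G \<le> p"
  using assms by (subst Ls.simps) (cases "left G"; auto intro!: Max.boundedI)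

lemma Rs_conjugate_if_opts:
  assumes "scoring_game G"
    and conjugate_opts: "\<And>X. X |\<in>| opts (left G) \<Longrightarrow> Ls (conjugate X) = - Rs X"
  shows "Rs (conjugate G) = - Ls G"
proof (cases "left G")
  case (Atom a)
  then have "right (conjugate G) = Atom (- a)"
    by (simp add: conjugate_eq_Atom_iff)
  with Atom show ?thesis
    by (simp add: Ls.simps Rs.simps)
next
  case (Opts A)
  then have "right (conjugate G) = Opts (conjugate |`| A)"
    by (simp add: conjugate.simps[of G])
  moreover have "fset A \<noteq> {}"
    using Opts scoring_game_nonempty(1)[OF assms(1)] by auto
  ultimately show ?thesis
    using Opts conjugate_opts by (simp add: Ls.simps[of G] Rs.simps image_image minus_Max_eq_Min)
qed

lemma stops_conjugate:
  assumes "scoring_game G"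
  shows "Rs (conjugate G) = - Ls G \<and> Ls (conjugate G) = - Rs G"
  using assms
proof (induction G rule: measure_induct_rule[where f = size])
  case (less G)
  have stops_move: "Rs (conjugate X) = - Ls X" "Ls (conjugate X) = - Rs X" if "X |\<in>| moves G" for X
    using less size_move_less[OF that] follower_move[OF that] scoring_game_follower by blast+
  have "Rs (conjugate G) = - Ls G"
    using less.prems stops_move(2) by (simp add: Rs_conjugate_if_opts)
  moreover have "Rs (conjugate (conjugate G)) = - Ls (conjugate G)"
    using less.prems stops_move(1)
    by (intro Rs_conjugate_if_opts)
      (auto simp: scoring_game_conjugate opts_conjugate conjugate_conjugate)
  ultimately show ?case
    by (simp add: conjugate_conjugate)
qed

lemmas Ls_conjugate = stops_conjugate[THEN conjunct2]

lemma mirror_reply: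
  assumes "Y |\<in>| opts (left (G \<oplus> conjugate G \<oplus> Z))" and "opts (left Z) = {||}"
  obtains X where "X |\<in>| moves G" and "X \<oplus> conjugate X \<oplus> Z |\<in>| opts (right Y)"
proof -
  consider (in_game) X where "X |\<in>| opts (left G)" "Y = X \<oplus> conjugate G \<oplus> Z"
    | (in_conjugate) X where "X |\<in>| opts (right G)" "Y = G \<oplus> conjugate X \<oplus> Z"
    using assms by (auto simp: opts_game_sum opts_conjugate)
  then show thesis
  proof cases
    case (in_game X)
    then show thesis
      by (intro that[of X]) (auto simp: opts_game_sum opts_conjugate)
  next
    case (in_conjugate X)
    then show thesis
      by (intro that[of X]) (auto simp: opts_game_sum opts_conjugate)
  qed
qed

lemma Ls_game_sum_conjugate_le:
  assumes "G \<in> GS" and scoring_Z: "scoring_game Z" and left_Z: "left Z = Atom p"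
  shows "Ls (G \<oplus> conjugate G \<oplus> Z) \<le> p"
  using assms(1)
proof (induction G rule: measure_induct_rule[where f = size])
  case (less G)
  have scoring: "scoring_game G" and guaranteed: "guaranteed G"
    using less.prems by (auto simp: GS_def)
  have mirrored: "Ls (X \<oplus> conjugate X \<oplus> Z) \<le> p" if "X |\<in>| moves G" for X
  proof (rule less.IH)
    show "size X < size G"
      using that by (rule size_move_less)
    show "X \<in> GS"
      using less.prems follower_move[OF that] by (rule GS_follower)
  qed
  show ?case
  proof (rule Ls_leI)
    show "left (G \<oplus> conjugate G \<oplus> Z) \<noteq> Opts {||}"
      by (intro scoring_game_nonempty scoring_game_game_sum scoring_game_conjugate scoring scoring_Z)
  next
    fix l assume "left (G \<oplus> conjugate G \<oplus> Z) = Atom l"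
    then obtain a b where "left G = Atom a" "right G = Atom b" "l = a - b + p"
      using left_Z by (auto simp: game_sum_eq_Atom_iff conjugate_eq_Atom_iff)
    then show "l \<le> p"
      using guaranteed guaranteed_left_atom_le_right_atom by fastforce
  next
    fix Y assume "Y |\<in>| opts (left (G \<oplus> conjugate G \<oplus> Z))"
    moreover have "opts (left Z) = {||}"
      using left_Z by simp
    ultimately obtain X where move: "X |\<in>| moves G"
      and reply: "X \<oplus> conjugate X \<oplus> Z |\<in>| opts (right Y)"
      by (rule mirror_reply)
    show "Rs Y \<le> p"
      using Rs_le_Ls_option[OF reply] mirrored[OF move] by linarith
  qed
qed

lemma Rs_game_sum_conjugate_ge:
  assumes "G \<in> GS" and "scoring_game Z" and "right Z = Atom q"
  shows "q \<le> Rs (G \<oplus> conjugate G \<oplus> Z)"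
proof -
  have "scoring_game (G \<oplus> conjugate G \<oplus> Z)"
    using assms by (simp add: GS_def scoring_game_game_sum scoring_game_conjugate)
  then have "- Rs (G \<oplus> conjugate G \<oplus> Z) = Ls (conjugate G \<oplus> G \<oplus> conjugate Z)"
    by (simp add: conjugate_game_sum conjugate_conjugate flip: Ls_conjugate)
  also have "\<dots> = Ls (G \<oplus> conjugate G \<oplus> conjugate Z)"
    by (simp add: game_sum_commute)
  also have "\<dots> \<le> - q"
    using assms
    by (intro Ls_game_sum_conjugate_le) (simp_all add: scoring_game_conjugate conjugate_eq_Atom_iff)
  finally show ?thesis
    by simp
qed

lemma abs_le_max_atom: "t \<in> atoms G \<Longrightarrow> \<bar>t\<bar> \<le> max_atom G"
  unfolding max_atom_def using finite_atoms[of G] by (auto intro: Max_ge)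

lemma max_atom_nonneg: "scoring_game G \<Longrightarrow> 0 \<le> max_atom G"
  using atoms_nonempty abs_le_max_atom abs_ge_zero order_trans by blast

lemma scoring_game_Atom_Atom: "scoring_game (Game (Atom p) (Atom q))"
proof -
  have "K = Game (Atom p) (Atom q)" if "follower (Game (Atom p) (Atom q)) K" for K
    using that by (induction rule: follower.induct) auto
  then show ?thesis
    unfolding scoring_game_def by force
qed

theorem theorem36:
  fixes G :: game and r s :: real
  assumes "G \<in> GS" and "r \<ge> 0" and "s \<ge> 0"
  shows "Ls (G \<oplus> adjoint r s G) < - r \<and> Rs (G \<oplus> adjoint r s G) > s"
proof -
  let ?m = "max_atom G"
  let ?Z = "Game (Atom (- ?m - r - 1)) (Atom (?m + s + 1))"
  have "0 \<le> ?m"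
    using assms(1) by (simp add: GS_def max_atom_nonneg)
  moreover have "G \<oplus> adjoint r s G = G \<oplus> conjugate G \<oplus> ?Z"
    by (simp add: adjoint_def game_sum_assoc)
  moreover have "Ls (G \<oplus> conjugate G \<oplus> ?Z) \<le> - ?m - r - 1"
    using assms(1) by (simp add: Ls_game_sum_conjugate_le scoring_game_Atom_Atom)
  moreover have "?m + s + 1 \<le> Rs (G \<oplus> conjugate G \<oplus> ?Z)"
    using assms(1) by (simp add: Rs_game_sum_conjugate_ge scoring_game_Atom_Atom)
  ultimately show ?thesis
    by simp
qed

end
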